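(* Let $M\in\mathbb{N}$, let $\phi_1,\dots,\phi_M\in L^2(U)$ be the first $M$ Karhunen-Loève eigenfunctions, let $V_0=\operatorname{span}\{\phi_1,\dots,\phi_M\}$, let $(V_k)_{k\in\mathbb{N}_0}$, $(W_k)_{k\in\mathbb{N}_0}$ be a multilevel decomposition of $L^2(U)$ starting from $V_0$, and for each $l\in\mathbb{N}_0$ let $\psi^l_1,\dots,\psi^l_{M_l}$ be an orthonormal basis of $W_l$, $M_l=\dim W_l$. Let $P:L^2(U)\to V_0^{\perp}$ be the orthogonal projection. Suppose that a signal $u$ has the form $u(\mathbf{x},\omega)=v_M(\mathbf{x},\omega)+w(\mathbf{x},\omega)$, where $v_M\in L^2_{\mathbb{P}}(\Omega;L^2(U))$ satisfies $v_M(\cdot,\omega)\in V_0$ almost surely and $w\in L^2_{\mathbb{P}}(\Omega;L^2(U))$, and let $$d^l_k(\omega)=\int_U u(\mathbf{x},\omega)\,\psi^l_k(\mathbf{x})\,d\mathbf{x},\qquad l\in\mathbb{N}_0,\ k=1,\dots,M_l.$$ Then $$Pu(\mathbf{x},\omega)=Pw(\mathbf{x},\omega)=\sum_{l\in\mathbb{N}_0}\sum_{k=1}^{M_l}d^l_k(\omega)\,\psi^l_k(\mathbf{x})$$ (equalities in $L^2(U)$ as functions of $\mathbf{x}$, for almost every $\omega$), and $$\sum_{l\in\mathbb{N}_0}\sum_{k=1}^{M_l}\mathbb{E}[(d^l_k)^2]=\|Pw\|^2_{L^2_{\mathbb{P}}(\Omega;L^2(U))}.$$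
   Context: $(\Omega,\mathcal{F},\mathbb{P})$ is a complete probability space, $U$ is a domain in $\mathbb{R}^d$, and $L^2(U)$ is the real Hilbert space of square integrable functions $U\to\mathbb{R}$ with inner product $\langle u,v\rangle=\int_U uv\,d\mathbf{x}$. $L^2_{\mathbb{P}}(\Omega;L^2(U))$ is the (Bochner) space of functions $\Omega\to L^2(U)$ with inner product $\int_\Omega\langle u,v\rangle\,d\mathbb{P}$. $\mathbb{N}_0=\{0,1,2,\dots\}$. The projection $P$ acts on a random field in the spatial variable: $Pu(\cdot,\omega)=P(u(\cdot,\omega))$. Karhunen-Loève eigenfunctions: for a random field $v\in L^2_{\mathbb{P}}(\Omega;L^2(U))$ with $\mathbb{E}[v]=0$ and covariance function $\mathrm{Cov}(\mathbf{x},\mathbf{y})=\mathbb{E}[v(\mathbf{x},\omega)v(\mathbf{y},\omega)]$, the functions $\phi_1,\phi_2,\dots$ form an orthonormal set in $L^2(U)$ of eigenfunctions of the operator $T(u)(\mathbf{x})=\int_U\mathrm{Cov}(\mathbf{x},\mathbf{y})u(\mathbf{y})\,d\mathbf{y}$ on $L^2(U)$, with non-negative eigenvalues $\lambda_1\ge\lambda_2\ge\cdots$. Multilevel decomposition: $V_0\subset V_1\subset\cdots\subset L^2(U)$ is a nested sequence of subspaces with $\overline{\bigcup_{k\in\mathbb{N}_0}V_k}=L^2(U)$ and $V_0=\operatorname{span}\{\phi_1,\dots,\phi_M\}$. The finite-dimensional subspaces $W_k\subset L^2(U)$, $k\in\mathbb{N}_0$, are defined by $V_{k+1}=V_k\oplus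 W_k$, where all direct sums are orthogonal, so that $\overline{V_0\oplus\bigoplus_{k\in\mathbb{N}_0}W_k}=L^2(U)$. *)

theory Defs
  imports "HOL-Probability.Probability"
begin

text \<open>The real Hilbert space $L^2(\mathbf{R}^d)$: square integrable Lebesgue measurable functions
  modulo equality almost everywhere.\<close>

definition square_integrable :: "('a::euclidean_space \<Rightarrow> real) \<Rightarrow> bool" where
  "square_integrable f \<longleftrightarrow>
     f \<in> borel_measurable lebesgue \<and> integrable lebesgue (\<lambda>x. (f x)\<^sup>2)"

definition L2_rel :: "('a::euclidean_space \<Rightarrow> real) \<Rightarrow> ('a \<Rightarrow> real) \<Rightarrow> bool" where
  "L2_rel f g \<longleftrightarrow>
     square_integrable f \<and> square_integrable g \<and> (AE x in lebesgue. f x = g x)"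

lemma square_integrable_zero: "square_integrable (\<lambda>x. 0)"
  by (simp add: square_integrable_def)

lemma square_integrable_mult:
  assumes "square_integrable f" "square_integrable g"
  shows "integrable lebesgue (\<lambda>x. f x * g x)"
proof (rule Bochner_Integration.integrable_bound)
  show "integrable lebesgue (\<lambda>x. (f x)\<^sup>2 + (g x)\<^sup>2)"
    using assms by (simp add: square_integrable_def)
  show "(\<lambda>x. f x * g x) \<in> borel_measurable lebesgue"
    using assms by (auto simp: square_integrable_def intro: borel_measurable_times)
  have "\<bar>a * b\<bar> \<le> a\<^sup>2 + b\<^sup>2" for a b :: real
  proof -
    have "2 * \<bar>a\<bar> * \<bar>b\<bar> \<le> \<bar>a\<bar>\<^sup>2 + \<bar>b\<bar>\<^sup>2"
      by (rule sum_squares_bound)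
    moreover have "0 \<le> \<bar>a\<bar> * \<bar>b\<bar>" by simp
    ultimately show ?thesis unfolding abs_mult power2_abs by linarith
  qed
  then show "AE x in lebesgue. norm (f x * g x) \<le> norm ((f x)\<^sup>2 + (g x)\<^sup>2)"
    by simp
qed

lemma square_integrable_add:
  assumes "square_integrable f" "square_integrable g"
  shows "square_integrable (\<lambda>x. f x + g x)"
proof -
  have "integrable lebesgue (\<lambda>x. (f x)\<^sup>2 + (g x)\<^sup>2 + 2 * (f x * g x))"
    using assms square_integrable_mult[OF assms] by (simp add: square_integrable_def)
  then have "integrable lebesgue (\<lambda>x. (f x + g x)\<^sup>2)"
    by (simp add: power2_sum algebra_simps)
  then show ?thesis
    using assms by (auto simp: square_integrable_def intro: borel_measurable_add)
qed

lemma square_integrable_scale: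
  assumes "square_integrable f"
  shows "square_integrable (\<lambda>x. c * f x)"
  using assms
  by (auto simp: square_integrable_def power_mult_distrib intro: borel_measurable_times)

quotient_type (overloaded) 'a L2 = "'a::euclidean_space \<Rightarrow> real" / partial: L2_rel
proof (rule part_equivpI)
  show "\<exists>x::'a \<Rightarrow> real. L2_rel x x"
    by (rule exI[of _ "\<lambda>x. 0"]) (simp add: L2_rel_def square_integrable_zero)
  show "symp L2_rel"
    by (auto simp: symp_def L2_rel_def)
  show "transp L2_rel"
    by (auto simp: transp_def L2_rel_def)
qed

lemma square_integrable_rep_L2: "square_integrable (rep_L2 f)"
  using Quotient_rep_reflp[OF Quotient_L2, of f] by (simp add: L2_rel_def)

instantiation L2 :: (euclidean_space) real_vector
begin

lift_definition zero_L2 :: "'a L2" is "\<lambda>x. 0"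
  by (simp add: L2_rel_def square_integrable_zero)

lift_definition plus_L2 :: "'a L2 \<Rightarrow> 'a L2 \<Rightarrow> 'a L2" is "\<lambda>f g x. f x + g x"
  by (auto simp: L2_rel_def square_integrable_add)

lift_definition scaleR_L2 :: "real \<Rightarrow> 'a L2 \<Rightarrow> 'a L2" is "\<lambda>c f x. c * f x"
  by (auto simp: L2_rel_def square_integrable_scale)

definition uminus_L2 :: "'a L2 \<Rightarrow> 'a L2" where
  "uminus_L2 f = (-1) *\<^sub>R f"

definition minus_L2 :: "'a L2 \<Rightarrow> 'a L2 \<Rightarrow> 'a L2" where
  "minus_L2 f g = f + (- g)"

instance
proof
  fix a b c :: "'a L2" and r s :: real
  show "a + b + c = a + (b + c)"
    by transfer (auto simp: L2_rel_def square_integrable_add algebra_simps)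
  show "a + b = b + a"
    by transfer (auto simp: L2_rel_def square_integrable_add algebra_simps)
  show "0 + a = a"
    by transfer (auto simp: L2_rel_def)
  show "- a + a = 0"
    unfolding uminus_L2_def
    by transfer (auto simp: L2_rel_def square_integrable_zero)
  show "a - b = a + - b"
    by (simp add: minus_L2_def)
  show "r *\<^sub>R (a + b) = r *\<^sub>R a + r *\<^sub>R b"
    by transfer (auto simp: L2_rel_def square_integrable_add square_integrable_scale
        algebra_simps)
  show "(r + s) *\<^sub>R a = r *\<^sub>R a + s *\<^sub>R a"
    by transfer (auto simp: L2_rel_def square_integrable_add square_integrable_scale
        algebra_simps)
  show "r *\<^sub>R s *\<^sub>R a = (r * s) *\<^sub>R a"
    by transfer (auto simp: L2_rel_def square_integrable_scale algebra_simps)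
  show "1 *\<^sub>R a = a"
    by transfer (auto simp: L2_rel_def)
qed

end

instantiation L2 :: (euclidean_space) real_inner
begin

lift_definition inner_L2 :: "'a L2 \<Rightarrow> 'a L2 \<Rightarrow> real" is
  "\<lambda>f g. LINT x|lebesgue. f x * g x"
proof -
  fix f f' g g' :: "'a \<Rightarrow> real"
  assume "L2_rel f f'" "L2_rel g g'"
  then show "(LINT x|lebesgue. f x * g x) = (LINT x|lebesgue. f' x * g' x)"
    by (intro integral_cong_AE) (auto simp: L2_rel_def square_integrable_def)
qed

definition norm_L2 :: "'a L2 \<Rightarrow> real" where
  "norm_L2 f = sqrt (inner f f)"

definition dist_L2 :: "'a L2 \<Rightarrow> 'a L2 \<Rightarrow> real" where
  "dist_L2 f g = norm (f - g)"

definition sgn_L2 :: "'a L2 \<Rightarrow> 'a L2" where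
  "sgn_L2 f = f /\<^sub>R norm f"

definition uniformity_L2 :: "('a L2 \<times> 'a L2) filter" where
  "uniformity_L2 = (INF e\<in>{0 <..}. principal {(f, g). dist f g < e})"

definition open_L2 :: "'a L2 set \<Rightarrow> bool" where
  "open_L2 S \<longleftrightarrow> (\<forall>f\<in>S. \<forall>\<^sub>F (f', g) in uniformity. f' = f \<longrightarrow> g \<in> S)"

instance
proof
  fix a b c :: "'a L2" and r :: real
  show "dist a b = norm (a - b)" by (simp add: dist_L2_def)
  show "sgn a = a /\<^sub>R norm a" by (simp add: sgn_L2_def)
  show "(uniformity :: ('a L2 \<times> 'a L2) filter) =
      (INF e\<in>{0 <..}. principal {(f, g). dist f g < e})"
    by (simp add: uniformity_L2_def)
  show "open S \<longleftrightarrow> (\<forall>f\<in>S. \<forall>\<^sub>F (f', g) in uniformity. f' = f \<longrightarrow> g \<in> S)"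
    for S :: "'a L2 set"
    by (simp add: open_L2_def)
  show "norm a = sqrt (a \<bullet> a)" by (simp add: norm_L2_def)
  show "a \<bullet> b = b \<bullet> a" by transfer (simp add: mult.commute)
  show "(a + b) \<bullet> c = a \<bullet> c + b \<bullet> c"
    by transfer (simp add: L2_rel_def distrib_right square_integrable_mult)
  show "(r *\<^sub>R a) \<bullet> b = r * (a \<bullet> b)"
    by transfer (simp add: mult.assoc)
  show "0 \<le> a \<bullet> a" by transfer simp
  show "a \<bullet> a = 0 \<longleftrightarrow> a = 0"
  proof transfer
    fix f :: "'a \<Rightarrow> real"
    assume f: "L2_rel f f"
    then have "(LINT x|lebesgue. f x * f x) = 0 \<longleftrightarrow> (AE x in lebesgue. f x * f x = 0)"
      by (intro integral_nonneg_eq_0_iff_AE)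
        (auto simp: L2_rel_def square_integrable_def power2_eq_square)
    also have "\<dots> \<longleftrightarrow> L2_rel f (\<lambda>x. 0)"
      using f by (simp add: L2_rel_def square_integrable_zero)
    finally show "(LINT x|lebesgue. f x * f x) = 0 \<longleftrightarrow> L2_rel f (\<lambda>x. 0)" .
  qed
qed

end

text \<open>$L^2(U)$ is identified with the closed subspace of those classes that vanish almost everywhere
  outside \<open>U\<close> (extension by zero); \<open>L2_class U f\<close> is the class of the square integrable function
  \<open>f\<close> on \<open>U\<close>, extended by zero.\<close>

definition L2_on :: "'a::euclidean_space set \<Rightarrow> 'a L2 set" where
  "L2_on U = {f. AE x in lebesgue. x \<notin> U \<longrightarrow> rep_L2 f x = 0}"

definition L2_class :: "'a::euclidean_space set \<Rightarrow> ('a \<Rightarrow> real) \<Rightarrow> 'a L2" where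
  "L2_class U f = abs_L2 (\<lambda>x. indicator U x * f x)"

definition square_integrable_on :: "('a::euclidean_space \<Rightarrow> real) \<Rightarrow> 'a set \<Rightarrow> bool" where
  "square_integrable_on f U \<longleftrightarrow>
     f \<in> borel_measurable (lebesgue_on U) \<and> integrable (lebesgue_on U) (\<lambda>x. (f x)\<^sup>2)"

text \<open>Bochner (strong) measurability, and the space of square integrable random elements of \<open>H\<close>.
  Its members are functions, not classes; equality in the Bochner space is equality almost
  surely.\<close>

definition strongly_measurable :: "'w measure \<Rightarrow> ('w \<Rightarrow> 'b::topological_space) \<Rightarrow> bool" where
  "strongly_measurable \<PP> v \<longleftrightarrow>
     (\<exists>s. (\<forall>n::nat. simple_function \<PP> (s n)) \<and> (AE \<omega> in \<PP>. (\<lambda>n. s n \<omega>) \<longlonglongrightarrow> v \<omega>))"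

definition bochner_L2 :: "'w measure \<Rightarrow> 'b::real_inner set \<Rightarrow> ('w \<Rightarrow> 'b) set" where
  "bochner_L2 \<PP> H =
     {v. (\<forall>\<omega>\<in>space \<PP>. v \<omega> \<in> H) \<and> strongly_measurable \<PP> v \<and>
         integrable \<PP> (\<lambda>\<omega>. (norm (v \<omega>))\<^sup>2)}"

definition bochner_norm :: "'w measure \<Rightarrow> ('w \<Rightarrow> 'b::real_inner) \<Rightarrow> real" where
  "bochner_norm \<PP> v = sqrt (LINT \<omega>|\<PP>. v \<omega> \<bullet> v \<omega>)"

text \<open>The covariance function involves point values, so it is formed from a jointly measurable
  version \<open>v \<omega> x\<close> of the random field; every element of the Bochner space has one. Here and
  below the sample point \<open>\<omega>\<close> is the first argument.\<close>

definition centered_random_field ::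
    "'w measure \<Rightarrow> 'a::euclidean_space set \<Rightarrow> ('w \<Rightarrow> 'a \<Rightarrow> real) \<Rightarrow> bool" where
  "centered_random_field \<PP> U v \<longleftrightarrow>
     (\<lambda>(\<omega>, x). v \<omega> x) \<in> borel_measurable (\<PP> \<Otimes>\<^sub>M lebesgue_on U) \<and>
     (\<forall>\<omega>\<in>space \<PP>. square_integrable_on (v \<omega>) U) \<and>
     (\<lambda>\<omega>. L2_class U (v \<omega>)) \<in> bochner_L2 \<PP> (L2_on U) \<and>
     (AE x in lebesgue_on U. (LINT \<omega>|\<PP>. v \<omega> x) = 0)"

definition covariance :: "'w measure \<Rightarrow> ('w \<Rightarrow> 'a \<Rightarrow> real) \<Rightarrow> 'a \<Rightarrow> 'a \<Rightarrow> real" where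
  "covariance \<PP> v x y = (LINT \<omega>|\<PP>. v \<omega> x * v \<omega> y)"

definition covariance_operator ::
    "'w measure \<Rightarrow> 'a::euclidean_space set \<Rightarrow> ('w \<Rightarrow> 'a \<Rightarrow> real) \<Rightarrow> ('a \<Rightarrow> real) \<Rightarrow> 'a \<Rightarrow> real" where
  "covariance_operator \<PP> U v f x = (LINT y|lebesgue_on U. covariance \<PP> v x y * f y)"

definition orthonormal_family :: "'i set \<Rightarrow> ('i \<Rightarrow> 'b::real_inner) \<Rightarrow> bool" where
  "orthonormal_family I e \<longleftrightarrow> (\<forall>i\<in>I. \<forall>j\<in>I. e i \<bullet> e j = (if i = j then 1 else 0))"

text \<open>The sequences of eigenfunctions and eigenvalues are indexed from 1; index 0 is unused.\<close>

definition karhunen_loeve ::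
    "'w measure \<Rightarrow> 'a::euclidean_space set \<Rightarrow> ('w \<Rightarrow> 'a \<Rightarrow> real) \<Rightarrow>
      (nat \<Rightarrow> 'a L2) \<Rightarrow> (nat \<Rightarrow> real) \<Rightarrow> bool" where
  "karhunen_loeve \<PP> U v \<phi> \<mu> \<longleftrightarrow>
     centered_random_field \<PP> U v \<and>
     (\<forall>i\<ge>1. \<phi> i \<in> L2_on U) \<and>
     orthonormal_family {1..} \<phi> \<and>
     (\<forall>i\<ge>1. AE x in lebesgue_on U.
        covariance_operator \<PP> U v (rep_L2 (\<phi> i)) x = \<mu> i * rep_L2 (\<phi> i) x) \<and>
     (\<forall>i\<ge>1. 0 \<le> \<mu> i \<and> \<mu> (Suc i) \<le> \<mu> i)"

definition multilevel_decomposition ::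
    "'b::real_inner set \<Rightarrow> (nat \<Rightarrow> 'b set) \<Rightarrow> (nat \<Rightarrow> 'b set) \<Rightarrow> bool" where
  "multilevel_decomposition H V W \<longleftrightarrow>
     (\<forall>k. subspace (V k) \<and> V k \<subseteq> H \<and> V k \<subseteq> V (Suc k)) \<and>
     closure (\<Union>k. V k) = H \<and>
     (\<forall>k. subspace (W k) \<and> W k \<subseteq> H \<and> (\<exists>B. finite B \<and> span B = W k)) \<and>
     (\<forall>k. \<forall>x\<in>V k. \<forall>y\<in>W k. orthogonal x y) \<and>
     (\<forall>k. V (Suc k) = {x + y | x y. x \<in> V k \<and> y \<in> W k})"

definition orthogonal_projection :: "'b::real_inner set \<Rightarrow> 'b set \<Rightarrow> ('b \<Rightarrow> 'b) \<Rightarrow> bool" where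
  "orthogonal_projection H S P \<longleftrightarrow> (\<forall>f\<in>H. P f \<in> S \<and> f - P f \<in> S\<^sup>\<bottom>)"

end

(* For f in L^2(U) the n-th partial sum S_n of the expansion in the \<psi>'s lies in V_n, and Pf - S_n is
   orthogonal to V_n. So S_n is the best approximation of Pf in V_n, and density of the union of the
   V_n gives S_n \<longlonglongrightarrow> Pf. The coefficients of u and w agree because v_M is orthogonal to every W_l, and
   Parseval's identity passes to expectations by dominated convergence. *)

theory Submission
  imports Defs
begin

section \<open>Expansion along a multilevel decomposition\<close>

lemma subspace_closure:
  fixes S :: "'b::real_normed_vector set"
  assumes "subspace S"
  shows "subspace (closure S)"
proof (rule subspaceI)
  show "0 \<in> closure S"
    using assms by (meson closure_subset subsetD subspace_0)
next
  fix x y assume "x \<in> closure S" "y \<in> closure S"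
  then obtain a b where "\<forall>n. a n \<in> S" "a \<longlonglongrightarrow> x" "\<forall>n. b n \<in> S" "b \<longlonglongrightarrow> y"
    unfolding closure_sequential by blast
  then show "x + y \<in> closure S"
    unfolding closure_sequential
    using assms by (intro exI[of _ "\<lambda>n. a n + b n"]) (auto intro: tendsto_add subspace_add)
next
  fix c x assume "x \<in> closure S"
  then obtain a where "\<forall>n. a n \<in> S" "a \<longlonglongrightarrow> x"
    unfolding closure_sequential by blast
  then show "c *\<^sub>R x \<in> closure S"
    unfolding closure_sequential
    using assms by (intro exI[of _ "\<lambda>n. c *\<^sub>R a n"]) (auto intro!: tendsto_intros subspace_scale)
qed

lemma subspace_UN_incseq:
  fixes V :: "nat \<Rightarrow> 'b::real_vector set"
  assumes "\<And>k. subspace (V k)" and "incseq V"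
  shows "subspace (\<Union>k. V k)"
proof (rule subspaceI)
  show "0 \<in> (\<Union>k. V k)"
    using assms(1) by (auto intro: subspace_0)
next
  fix x y assume "x \<in> (\<Union>k. V k)" "y \<in> (\<Union>k. V k)"
  then obtain i j where "x \<in> V i" "y \<in> V j" by blast
  then have "x \<in> V (max i j)" "y \<in> V (max i j)"
    using \<open>incseq V\<close> by (meson incseqD max.cobounded1 max.cobounded2 subsetD)+
  then show "x + y \<in> (\<Union>k. V k)"
    using assms(1) subspace_add by blast
next
  fix c x assume "x \<in> (\<Union>k. V k)"
  then show "c *\<^sub>R x \<in> (\<Union>k. V k)"
    using assms(1) subspace_scale by blast
qed

lemma orthonormal_familyD:
  "orthonormal_family I e \<Longrightarrow> i \<in> I \<Longrightarrow> j \<in> I \<Longrightarrow> e i \<bullet> e j = (if i = j then 1 else 0)"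
  by (simp add: orthonormal_family_def)

lemma inner_orthonormal_sum:
  assumes "finite I" "orthonormal_family I e" "j \<in> I"
  shows "(\<Sum>i\<in>I. c i *\<^sub>R e i) \<bullet> e j = c j"
proof -
  have "(\<Sum>i\<in>I. c i *\<^sub>R e i) \<bullet> e j = (\<Sum>i\<in>I. if i = j then c i else 0)"
    unfolding inner_sum_left using assms by (intro sum.cong) (auto simp: orthonormal_familyD)
  then show ?thesis using assms by simp
qed

lemma orthogonal_spanI:
  assumes "\<And>b. b \<in> B \<Longrightarrow> x \<bullet> b = 0" "y \<in> span B"
  shows "x \<bullet> y = 0"
  using orthogonal_to_span[OF assms(2), of x] assms(1) by (auto simp: orthogonal_def)

text \<open>The difference of the projections lies in \<open>S\<close> and the difference of the
  residuals in its orthogonal complement, so Pythagoras applies. This gives continuity of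
  \<open>P\<close> on \<open>H\<close> directly from its defining property, without passing through
  linearity.\<close>

lemma orthogonal_projection_dist_le:
  assumes P: "orthogonal_projection H S P" and "subspace S" "f \<in> H" "g \<in> H"
  shows "dist (P f) (P g) \<le> dist f g"
proof -
  have *: "P h \<in> S" "h - P h \<in> S\<^sup>\<bottom>" if "h \<in> H" for h
    using P that by (auto simp: orthogonal_projection_def)
  have "P f - P g \<in> S" "(f - P f) - (g - P g) \<in> S\<^sup>\<bottom>"
    using * assms by (auto intro: subspace_diff subspace_orthogonal_comp)
  then have "orthogonal (P f - P g) ((f - P f) - (g - P g))"
    by (simp add: orthogonal_comp_def)
  from norm_add_Pythagorean[OF this]
  have "(norm (P f - P g))\<^sup>2 \<le> (norm (f - g))\<^sup>2"
    by (simp add: algebra_simps)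
  then show ?thesis
    unfolding dist_norm using power2_le_imp_le norm_ge_zero by blast
qed

section \<open>The multilevel expansion in an abstract real inner product space\<close>

locale multilevel_basis =
  fixes H :: "'b::real_inner set" and V W :: "nat \<Rightarrow> 'b set"
    and \<psi> :: "nat \<Rightarrow> nat \<Rightarrow> 'b" and m :: "nat \<Rightarrow> nat" and P :: "'b \<Rightarrow> 'b"
  assumes decomposition: "multilevel_decomposition H V W"
    and orthonormal: "\<And>l. orthonormal_family {1..m l} (\<psi> l)"
    and span_basis: "\<And>l. span (\<psi> l ` {1..m l}) = W l"
    and projection: "orthogonal_projection H (H \<inter> (V 0)\<^sup>\<bottom>) P"
begin

text \<open>This is the orthogonal projection of \<open>f\<close> onto \<open>W l\<close>, in
  coordinates.\<close>

definition detail :: "'b \<Rightarrow> nat \<Rightarrow> 'b" where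
  "detail f l = (\<Sum>k=1..m l. (f \<bullet> \<psi> l k) *\<^sub>R \<psi> l k)"

lemma subspace_V: "subspace (V k)" and V_Suc: "V k \<subseteq> V (Suc k)" and W_subset: "W k \<subseteq> H"
  and closure_UN_V: "closure (\<Union>k. V k) = H" and subspace_W: "subspace (W k)"
  and orthogonal_V_W: "x \<in> V k \<Longrightarrow> y \<in> W k \<Longrightarrow> x \<bullet> y = 0"
  and V_Suc_eq: "V (Suc k) = {x + y | x y. x \<in> V k \<and> y \<in> W k}"
  using decomposition unfolding multilevel_decomposition_def orthogonal_def by blast+

lemma incseq_V: "incseq V"
  using V_Suc by (rule incseq_SucI)

text \<open>Density presents \<open>H\<close> as the closure of an increasing union of
  subspaces.\<close>

lemma subspace_H: "subspace H"
  using subspace_closure[OF subspace_UN_incseq[OF subspace_V incseq_V]] closure_UN_V by simp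

lemma subspace_range: "subspace (H \<inter> (V 0)\<^sup>\<bottom>)"
  by (intro subspace_inter subspace_H subspace_orthogonal_comp)

lemma basis_in_W: "k \<in> {1..m l} \<Longrightarrow> \<psi> l k \<in> W l"
  unfolding span_basis[symmetric] by (intro span_base imageI)

lemma basis_in_H: "k \<in> {1..m l} \<Longrightarrow> \<psi> l k \<in> H"
  using basis_in_W W_subset by blast

text \<open>By nestedness \<open>x\<close> lies in \<open>V l\<close>, which is orthogonal to
  \<open>W l\<close>. Hence the \<open>V 0\<close> part of a signal is invisible to every
  coefficient.\<close>

lemma orthogonal_V0_basis: "x \<in> V 0 \<Longrightarrow> k \<in> {1..m l} \<Longrightarrow> x \<bullet> \<psi> l k = 0"
  using incseqD[OF incseq_V, of 0 l] orthogonal_V_W basis_in_W by blast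

lemma basis_in_range: "k \<in> {1..m l} \<Longrightarrow> \<psi> l k \<in> H \<inter> (V 0)\<^sup>\<bottom>"
  using basis_in_H orthogonal_V0_basis by (auto simp: orthogonal_comp_def orthogonal_def)

lemma projection_in_H: "f \<in> H \<Longrightarrow> P f \<in> H"
  using projection by (auto simp: orthogonal_projection_def)

text \<open>The residual \<open>f - P f\<close> is orthogonal to the target space of
  \<open>P\<close>, and that space contains the basis vectors.\<close>

lemma inner_projection_basis:
  assumes "f \<in> H" "k \<in> {1..m l}"
  shows "P f \<bullet> \<psi> l k = f \<bullet> \<psi> l k"
proof -
  have "f - P f \<in> (H \<inter> (V 0)\<^sup>\<bottom>)\<^sup>\<bottom>"
    using projection assms by (auto simp: orthogonal_projection_def)
  then have "\<psi> l k \<bullet> (f - P f) = 0"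
    using basis_in_range[OF assms(2)] unfolding orthogonal_comp_def orthogonal_def by blast
  then show ?thesis by (simp add: algebra_simps inner_commute)
qed

lemma detail_in_W: "detail f l \<in> W l"
  unfolding detail_def by (intro subspace_sum subspace_scale subspace_W basis_in_W)

lemma inner_detail_basis: "k \<in> {1..m l} \<Longrightarrow> detail f l \<bullet> \<psi> l k = f \<bullet> \<psi> l k"
  unfolding detail_def by (intro inner_orthonormal_sum orthonormal) auto

lemma detail_cong:
  "(\<And>k. k \<in> {1..m l} \<Longrightarrow> f \<bullet> \<psi> l k = g \<bullet> \<psi> l k) \<Longrightarrow> detail f l = detail g l"
  unfolding detail_def by (intro sum.cong) auto

lemma inner_self_detail: "f \<bullet> detail f l = (\<Sum>k=1..m l. (f \<bullet> \<psi> l k)\<^sup>2)"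
  by (simp add: detail_def inner_sum_right power2_eq_square)

text \<open>The index shift is exact: \<open>W l\<close> is the increment from \<open>V l\<close> to
  \<open>V (Suc l)\<close>, so the details below \<open>n\<close> end in \<open>V n\<close>, and the
  empty sum is 0 in \<open>V 0\<close>.\<close>

lemma sum_detail_in_V: "(\<Sum>l<n. detail f l) \<in> V n"
proof (induction n)
  case 0
  then show ?case by (simp add: subspace_0 subspace_V)
next
  case (Suc n)
  then show ?case unfolding V_Suc_eq sum.lessThan_Suc using detail_in_W by blast
qed

text \<open>Induction along \<open>V (Suc n) = V n + W n\<close>; the base case is the assumption on
  \<open>g\<close>. Against \<open>V n\<close>, the new detail contributes nothing because it lies
  in \<open>W n\<close>. Against \<open>W n\<close>, the earlier sum contributes nothing and the new
  detail has the same coefficients as \<open>g\<close>.\<close>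

lemma residual_orthogonal:
  assumes "g \<in> (V 0)\<^sup>\<bottom>" "x \<in> V n"
  shows "(g - (\<Sum>l<n. detail g l)) \<bullet> x = 0"
  using assms(2)
proof (induction n arbitrary: x)
  case 0
  then show ?case using assms(1) by (auto simp: orthogonal_comp_def orthogonal_def inner_commute)
next
  case (Suc n)
  let ?S = "\<Sum>l<n. detail g l"
  obtain y z where x: "x = y + z" and y: "y \<in> V n" and z: "z \<in> W n"
    using Suc.prems unfolding V_Suc_eq by blast
  have "(g - (?S + detail g n)) \<bullet> y = 0"
    using Suc.IH[OF y] orthogonal_V_W[OF y detail_in_W, of g]
    by (simp add: algebra_simps inner_commute)
  moreover have "(g - (?S + detail g n)) \<bullet> z = 0"
  proof (rule orthogonal_spanI)
    show "z \<in> span (\<psi> n ` {1..m n})" using z span_basis by simp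
    fix b assume "b \<in> \<psi> n ` {1..m n}"
    then obtain k where "b = \<psi> n k" "k \<in> {1..m n}" by blast
    then show "(g - (?S + detail g n)) \<bullet> b = 0"
      using inner_detail_basis orthogonal_V_W[OF sum_detail_in_V basis_in_W]
      by (simp add: algebra_simps)
  qed
  ultimately show ?case by (simp add: x inner_add_right)
qed

lemma detail_sums:
  assumes "g \<in> H" "g \<in> (V 0)\<^sup>\<bottom>"
  shows "detail g sums g"
  unfolding sums_def
proof (rule LIMSEQ_I)
  fix e :: real assume "0 < e"
  then obtain y N where y: "y \<in> V N" "dist y g < e"
    using assms(1) closure_UN_V closure_approachable by (metis UN_E)
  have "norm ((\<Sum>l<n. detail g l) - g) < e" if "N \<le> n" for n
  proof -
    let ?S = "\<Sum>l<n. detail g l"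
    \<comment> \<open>For \<open>n\<close> beyond \<open>N\<close> the approximant \<open>y\<close>
      is in \<open>V n\<close> too, so \<open>g - y = (g - ?S) + (?S - y)\<close> is an orthogonal
      splitting.\<close>
    have "?S - y \<in> V n"
      using y incseqD[OF incseq_V that] subspace_V by (blast intro: subspace_diff sum_detail_in_V)
    then have "orthogonal (g - ?S) (?S - y)"
      using residual_orthogonal assms(2) by (simp add: orthogonal_def)
    from norm_add_Pythagorean[OF this] have "(norm (g - ?S))\<^sup>2 \<le> (norm (g - y))\<^sup>2"
      by simp
    then have "norm (g - ?S) \<le> norm (g - y)"
      using power2_le_imp_le norm_ge_zero by blast
    then show ?thesis using y(2) by (simp add: dist_norm norm_minus_commute)
  qed
  then show "\<exists>N. \<forall>n\<ge>N. norm ((\<Sum>l<n. detail g l) - g) < e" by blast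
qed

text \<open>Details depend only on coefficients, and \<open>f\<close> and \<open>P f\<close> have
  the same ones; the expansion of \<open>P f\<close> is therefore that of \<open>f\<close>.\<close>

lemma detail_sums_projection:
  assumes "f \<in> H"
  shows "detail f sums P f"
proof -
  have "detail (P f) = detail f"
    using inner_projection_basis[OF assms] by (intro ext detail_cong) auto
  moreover have "P f \<in> H \<inter> (V 0)\<^sup>\<bottom>"
    using projection assms by (auto simp: orthogonal_projection_def)
  ultimately show ?thesis using detail_sums[of "P f"] by simp
qed

text \<open>Pair the expansion with \<open>P f\<close> by continuity of the inner product, then
  replace \<open>P f\<close> by \<open>f\<close> in each term, since both have the same
  coefficients.\<close>

lemma parseval:
  assumes "f \<in> H"
  shows "(\<lambda>l. \<Sum>k=1..m l. (f \<bullet> \<psi> l k)\<^sup>2) sums (norm (P f))\<^sup>2"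
proof -
  have "(\<lambda>l. P f \<bullet> detail f l) sums (P f \<bullet> P f)"
    by (rule bounded_linear.sums[OF bounded_linear_inner_right detail_sums_projection[OF assms]])
  moreover have "P f \<bullet> detail f l = f \<bullet> detail f l" for l
    by (simp add: detail_def inner_sum_right inner_projection_basis[OF assms])
  ultimately show ?thesis by (simp add: inner_self_detail power2_norm_eq_inner)
qed

lemma norm_projection_le:
  assumes "f \<in> H"
  shows "norm (P f) \<le> norm f"
proof -
  \<comment> \<open>\<open>P 0 = 0\<close> follows from uniqueness of limits: the zero series
    converges both to 0 and to \<open>P 0\<close>. The bound is then nonexpansiveness compared with
    0.\<close>
  have "detail 0 = (\<lambda>_. 0)"
    by (simp add: detail_def fun_eq_iff)
  then have "P 0 = 0"
    using detail_sums_projection[OF subspace_0[OF subspace_H]] sums_zero sums_unique2 by metis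
  then show ?thesis
    using orthogonal_projection_dist_le[OF projection subspace_range assms subspace_0[OF subspace_H]]
    by simp
qed

text \<open>Both projections are the sum of one and the same series, because adding \<open>x\<close>
  changes no coefficient.\<close>

lemma projection_add_V0:
  assumes "f \<in> H" "x \<in> H" "x \<in> V 0"
  shows "P (x + f) = P f"
proof -
  have "detail (x + f) = detail f"
    using orthogonal_V0_basis[OF assms(3)] by (intro ext detail_cong) (simp add: inner_add_left)
  then show ?thesis
    using detail_sums_projection[of "x + f"] detail_sums_projection[of f] assms
      subspace_add[OF subspace_H] sums_unique2 by metis
qed

end

section \<open>Strongly measurable functions\<close>

text \<open>The preimages under \<open>f\<close> and \<open>g\<close> differ within a null set, and
  completeness makes every subset of a null set measurable.\<close>

lemma (in complete_measure) borel_measurable_AE_eq: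
  assumes "f \<in> borel_measurable M" "AE x in M. f x = g x"
  shows "g \<in> borel_measurable M"
proof (rule measurableI)
  fix A :: "'b set" assume A: "A \<in> sets borel"
  show "g -` A \<inter> space M \<in> sets M"
  proof (rule in_sets_AE)
    show "AE x in M. x \<in> f -` A \<inter> space M \<longleftrightarrow> x \<in> g -` A \<inter> space M"
      using assms(2) by eventually_elim auto
    show "f -` A \<inter> space M \<in> sets M" using assms(1) A by (rule measurable_sets)
  qed auto
qed simp

lemma (in complete_measure) borel_measurable_AE_lim:
  fixes f :: "nat \<Rightarrow> 'a \<Rightarrow> real"
  assumes "\<And>n. f n \<in> borel_measurable M" "AE x in M. (\<lambda>n. f n x) \<longlonglongrightarrow> g x"
  shows "g \<in> borel_measurable M"
proof (rule borel_measurable_AE_eq)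
  \<comment> \<open>Where the sequence diverges, \<open>lim\<close> takes an unspecified value; this
    happens only on a null set.\<close>
  show "(\<lambda>x. lim (\<lambda>n. f n x)) \<in> borel_measurable M"
    using assms(1) by measurable
  show "AE x in M. lim (\<lambda>n. f n x) = g x"
    using assms(2) by eventually_elim (rule limI)
qed

lemma (in complete_measure) borel_measurable_strongly_measurable:
  fixes g :: "'b::topological_space \<Rightarrow> real"
  assumes "strongly_measurable M v" "continuous_on UNIV g"
  shows "(\<lambda>\<omega>. g (v \<omega>)) \<in> borel_measurable M"
proof -
  obtain s where s: "\<And>n::nat. simple_function M (s n)" "AE \<omega> in M. (\<lambda>n. s n \<omega>) \<longlonglongrightarrow> v \<omega>"
    using assms(1) unfolding strongly_measurable_def by blast
  show ?thesis
  proof (rule borel_measurable_AE_lim)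
    show "(\<lambda>\<omega>. g (s n \<omega>)) \<in> borel_measurable M" for n
      using borel_measurable_simple_function[OF simple_function_compose1[OF s(1)]] .
    show "AE \<omega> in M. (\<lambda>n. g (s n \<omega>)) \<longlonglongrightarrow> g (v \<omega>)"
      using s(2) by eventually_elim (rule continuous_on_tendsto_compose[OF assms(2)], auto)
  qed
qed

text \<open>The values of the approximating simple functions may lie outside \<open>H\<close>; they are moved to almost
  nearest points of \<open>H\<close>, since an exact nearest point need not exist.\<close>

lemma strongly_measurable_simple_in:
  fixes v :: "'w \<Rightarrow> 'b::metric_space"
  assumes "strongly_measurable M v" "AE \<omega> in M. v \<omega> \<in> H" "H \<noteq> {}"
  obtains s where "\<And>n::nat. simple_function M (s n)" "\<And>n \<omega>. s n \<omega> \<in> H"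
    "AE \<omega> in M. (\<lambda>n. s n \<omega>) \<longlonglongrightarrow> v \<omega>"
proof -
  obtain s where s: "\<And>n::nat. simple_function M (s n)" "AE \<omega> in M. (\<lambda>n. s n \<omega>) \<longlonglongrightarrow> v \<omega>"
    using assms(1) unfolding strongly_measurable_def by blast
  have "\<exists>y\<in>H. dist x y < infdist x H + inverse (real (Suc n))" for x n
  proof (rule ccontr)
    assume "\<not> ?thesis"
    \<comment> \<open>Otherwise the left side would be a lower bound for all distances from
      \<open>x\<close> to \<open>H\<close>, hence at most their infimum.\<close>
    then have "infdist x H + inverse (real (Suc n)) \<le> infdist x H"
      unfolding infdist_notempty[OF assms(3)]
      by (intro cINF_greatest assms(3)) (auto simp: not_less infdist_notempty[OF assms(3)])
    moreover have "0 < inverse (real (Suc n))" by simp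
    ultimately show False by linarith
  qed
  then have "\<forall>n x. \<exists>y. y \<in> H \<and> dist x y < infdist x H + inverse (real (Suc n))"
    by blast
  \<comment> \<open>\<open>r n\<close> depends on the value alone and not on the sample point, so
    composing it with \<open>s n\<close> keeps finitely many values and measurability.\<close>
  then obtain r where r: "\<And>n x. r n x \<in> H"
      "\<And>n x. dist x (r n x) < infdist x H + inverse (real (Suc n))"
    by metis
  show ?thesis
  proof
    show "simple_function M (\<lambda>\<omega>. r n (s n \<omega>))" for n
      using s(1) by (rule simple_function_compose1)
    show "r n (s n \<omega>) \<in> H" for n \<omega> by (rule r)
    show "AE \<omega> in M. (\<lambda>n. r n (s n \<omega>)) \<longlonglongrightarrow> v \<omega>"
      using s(2) assms(2)
    proof eventually_elim
      case (elim \<omega>)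
      \<comment> \<open>The factor 2: one copy is the triangle inequality through
        \<open>s n \<omega>\<close>; the other bounds \<open>infdist (s n \<omega>) H\<close>, as
        \<open>v \<omega>\<close> belongs to \<open>H\<close>.\<close>
      have bound: "dist (r n (s n \<omega>)) (v \<omega>) \<le> 2 * dist (s n \<omega>) (v \<omega>) + inverse (real (Suc n))" for n
        using r(2)[of "s n \<omega>" n] infdist_le[OF elim(2), of "s n \<omega>"]
          dist_triangle[of "r n (s n \<omega>)" "v \<omega>" "s n \<omega>"] dist_commute[of "s n \<omega>" "r n (s n \<omega>)"]
        by linarith
      have "(\<lambda>n. 2 * dist (s n \<omega>) (v \<omega>) + inverse (real (Suc n))) \<longlonglongrightarrow> 2 * 0 + 0"
        using iffD1[OF tendsto_dist_iff elim(1)]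
        by (intro tendsto_add tendsto_mult tendsto_const LIMSEQ_inverse_real_of_nat)
      then have "(\<lambda>n. dist (r n (s n \<omega>)) (v \<omega>)) \<longlonglongrightarrow> 0"
        using bound by (intro Lim_null_comparison[of "\<lambda>n. dist (r n (s n \<omega>)) (v \<omega>)"]) auto
      then show ?case by (rule iffD2[OF tendsto_dist_iff])
    qed
  qed
qed

text \<open>Continuity of \<open>g\<close> is available only on \<open>H\<close>, so the
  approximants are first moved into \<open>H\<close>. It is applied to \<open>P\<close>, whose
  values outside \<open>H\<close> are unspecified.\<close>

lemma strongly_measurable_continuous_on_compose:
  fixes v :: "'w \<Rightarrow> 'b::metric_space" and g :: "'b \<Rightarrow> 'c::topological_space"
  assumes v: "strongly_measurable M v" "AE \<omega> in M. v \<omega> \<in> H" and g: "continuous_on H g"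
  shows "strongly_measurable M (\<lambda>\<omega>. g (v \<omega>))"
proof (cases "H = {}")
  case True
  \<comment> \<open>With \<open>H\<close> empty the whole space is null, so any constant sequence
    converges almost everywhere.\<close>
  have "strongly_measurable M h" if "AE \<omega> in M. False" for h :: "'w \<Rightarrow> 'c"
    unfolding strongly_measurable_def
    by (intro exI[of _ "\<lambda>_ _. undefined"]) (use that in auto)
  then show ?thesis using v(2) True by simp
next
  case False
  obtain s where s: "\<And>n::nat. simple_function M (s n)" "\<And>n \<omega>. s n \<omega> \<in> H"
    "AE \<omega> in M. (\<lambda>n. s n \<omega>) \<longlonglongrightarrow> v \<omega>"
    using strongly_measurable_simple_in[OF v False] by blast
  have "AE \<omega> in M. (\<lambda>n. g (s n \<omega>)) \<longlonglongrightarrow> g (v \<omega>)"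
    using s(3) v(2) by eventually_elim (rule continuous_on_tendsto_compose[OF g], auto simp: s(2))
  then show ?thesis
    unfolding strongly_measurable_def using s(1)
    by (intro exI[of _ "\<lambda>n \<omega>. g (s n \<omega>)"]) (simp add: simple_function_compose1)
qed

section \<open>The inner product of \<open>L\<^sup>2(U)\<close>\<close>

lemma inner_L2_rep: "f \<bullet> g = (LINT x|lebesgue. rep_L2 f x * rep_L2 g x)"
  by (simp add: inner_L2.rep_eq)

text \<open>Since \<open>g\<close> vanishes almost everywhere outside \<open>U\<close>, integrating
  over \<open>U\<close> loses nothing. This identifies the coefficient integrals with abstract inner
  products.\<close>

lemma inner_L2_on:
  assumes "U \<in> sets lebesgue" "g \<in> L2_on U"
  shows "(LINT x|lebesgue_on U. rep_L2 f x * rep_L2 g x) = f \<bullet> g"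
proof -
  have m: "rep_L2 f \<in> borel_measurable lebesgue" "rep_L2 g \<in> borel_measurable lebesgue"
    using square_integrable_rep_L2 by (auto simp: square_integrable_def)
  have "(LINT x|lebesgue_on U. rep_L2 f x * rep_L2 g x)
      = (LINT x|lebesgue. indicator U x *\<^sub>R (rep_L2 f x * rep_L2 g x))"
    using assms(1) by (intro integral_restrict_space) auto
  also have "\<dots> = (LINT x|lebesgue. rep_L2 f x * rep_L2 g x)"
  proof (rule integral_cong_AE)
    show "AE x in lebesgue. indicator U x *\<^sub>R (rep_L2 f x * rep_L2 g x) = rep_L2 f x * rep_L2 g x"
      using assms(2) unfolding L2_on_def mem_Collect_eq
      by eventually_elim (auto simp: indicator_def)
  qed (use m assms(1) in measurable)
  finally show ?thesis by (simp add: inner_L2_rep)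
qed

text \<open>Bochner membership of \<open>P w\<close> and integrability of the squared coefficients
  belong to the conclusion because \<open>LINT\<close> is 0 for a nonintegrable function; they give
  the final identity its intended meaning.\<close>

theorem theorem3p4:
  fixes \<PP> :: "'w measure"
    and U :: "(real ^ 'd) set"
    and v :: "'w \<Rightarrow> real ^ 'd \<Rightarrow> real"
    and \<phi> :: "nat \<Rightarrow> (real ^ 'd) L2"
    and \<mu> :: "nat \<Rightarrow> real"
    and M :: nat
    and V W :: "nat \<Rightarrow> (real ^ 'd) L2 set"
    and \<psi> :: "nat \<Rightarrow> nat \<Rightarrow> (real ^ 'd) L2"
    and P :: "(real ^ 'd) L2 \<Rightarrow> (real ^ 'd) L2"
    and u v\<^sub>M w :: "'w \<Rightarrow> (real ^ 'd) L2"
    and d :: "nat \<Rightarrow> nat \<Rightarrow> 'w \<Rightarrow> real"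
  assumes "prob_space \<PP>" and "complete_measure \<PP>"
    and "open U" and "connected U" and "U \<noteq> {}"
    and "karhunen_loeve \<PP> U v \<phi> \<mu>"
    and "1 \<le> M"
    and "multilevel_decomposition (L2_on U) V W"
    and "V 0 = span (\<phi> ` {1..M})"
    and "\<And>l. orthonormal_family {1..dim (W l)} (\<psi> l)"
    and "\<And>l. span (\<psi> l ` {1..dim (W l)}) = W l"
    and "orthogonal_projection (L2_on U) (L2_on U \<inter> (V 0)\<^sup>\<bottom>) P"
    and "v\<^sub>M \<in> bochner_L2 \<PP> (L2_on U)"
    and "AE \<omega> in \<PP>. v\<^sub>M \<omega> \<in> V 0"
    and "w \<in> bochner_L2 \<PP> (L2_on U)"
    and "AE \<omega> in \<PP>. u \<omega> = v\<^sub>M \<omega> + w \<omega>"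
    and "\<And>l k \<omega>. d l k \<omega> =
           (LINT x|lebesgue_on U. rep_L2 (u \<omega>) x * rep_L2 (\<psi> l k) x)"
  shows "(AE \<omega> in \<PP>. P (u \<omega>) = P (w \<omega>) \<and>
             (\<lambda>l. \<Sum>k=1..dim (W l). d l k \<omega> *\<^sub>R \<psi> l k) sums P (w \<omega>)) \<and>
         (\<lambda>\<omega>. P (w \<omega>)) \<in> bochner_L2 \<PP> (L2_on U) \<and>
         (\<forall>l. \<forall>k\<in>{1..dim (W l)}. integrable \<PP> (\<lambda>\<omega>. (d l k \<omega>)\<^sup>2)) \<and>
         (\<lambda>l. \<Sum>k=1..dim (W l). LINT \<omega>|\<PP>. (d l k \<omega>)\<^sup>2) sums
           (bochner_norm \<PP> (\<lambda>\<omega>. P (w \<omega>)))\<^sup>2"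
proof -
  let ?H = "L2_on U"
  let ?M = "\<lambda>l. dim (W l)"
  interpret complete_measure \<PP> by fact
  interpret multilevel_basis ?H V W \<psi> ?M P
    by unfold_locales (fact assms)+
  have w: "strongly_measurable \<PP> w" "AE \<omega> in \<PP>. w \<omega> \<in> ?H" "integrable \<PP> (\<lambda>\<omega>. (norm (w \<omega>))\<^sup>2)"
    and vM: "AE \<omega> in \<PP>. v\<^sub>M \<omega> \<in> ?H"
    using assms(13,15) by (auto simp: bochner_L2_def)
  have U: "U \<in> sets lebesgue"
    using \<open>open U\<close> by (simp add: borel_open sets_completionI_sets)
  have d_eq: "d l k \<omega> = u \<omega> \<bullet> \<psi> l k" if "k \<in> {1..?M l}" for l k \<omega>
    unfolding assms(17) by (rule inner_L2_on[OF U basis_in_H[OF that]])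
  \<comment> \<open>The exceptional set comes only from the splitting of \<open>u\<close> and from
    \<open>v\<^sub>M \<omega> \<in> V 0\<close>, so one null set serves all indices.\<close>
  have d_AE: "AE \<omega> in \<PP>. \<forall>l. \<forall>k\<in>{1..?M l}. d l k \<omega> = w \<omega> \<bullet> \<psi> l k"
    using assms(14,16) by eventually_elim (auto simp: d_eq orthogonal_V0_basis inner_add_left)
  have expansion: "AE \<omega> in \<PP>. P (u \<omega>) = P (w \<omega>) \<and>
      (\<lambda>l. \<Sum>k=1..?M l. d l k \<omega> *\<^sub>R \<psi> l k) sums P (w \<omega>)"
    using assms(14,16) vM w(2) d_AE
  proof eventually_elim
    case (elim \<omega>)
    have "(\<Sum>k=1..?M l. d l k \<omega> *\<^sub>R \<psi> l k) = detail (w \<omega>) l" for l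
      unfolding detail_def using elim by (intro sum.cong) auto
    then show ?case
      using detail_sums_projection elim projection_add_V0 by simp
  qed

  have "continuous_on ?H P"
    unfolding continuous_on_iff
    using orthogonal_projection_dist_le[OF projection subspace_range] by (meson le_less_trans)
  then have Pw: "strongly_measurable \<PP> (\<lambda>\<omega>. P (w \<omega>))"
    by (rule strongly_measurable_continuous_on_compose[OF w(1,2)])
  have Pw_meas: "(\<lambda>\<omega>. (norm (P (w \<omega>)))\<^sup>2) \<in> borel_measurable \<PP>"
    by (rule borel_measurable_strongly_measurable[OF Pw]) (intro continuous_intros)
  have Pw_int: "integrable \<PP> (\<lambda>\<omega>. (norm (P (w \<omega>)))\<^sup>2)"
  proof (rule Bochner_Integration.integrable_bound[OF w(3) Pw_meas])
    show "AE \<omega> in \<PP>. norm ((norm (P (w \<omega>)))\<^sup>2) \<le> norm ((norm (w \<omega>))\<^sup>2)"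
      using w(2) by eventually_elim (simp add: norm_projection_le power_mono)
  qed
  have Pw_bochner: "(\<lambda>\<omega>. P (w \<omega>)) \<in> bochner_L2 \<PP> ?H"
    using Pw Pw_int assms(15) projection_in_H by (simp add: bochner_L2_def)

  \<comment> \<open>Measurability is inherited from \<open>w\<close>: the coefficients of
    \<open>w\<close> are continuous in its value, and completeness carries this over to
    \<open>d\<close>.\<close>
  have d_meas: "(\<lambda>\<omega>. (d l k \<omega>)\<^sup>2) \<in> borel_measurable \<PP>" if k: "k \<in> {1..?M l}" for l k
  proof (rule borel_measurable_AE_eq)
    show "(\<lambda>\<omega>. (w \<omega> \<bullet> \<psi> l k)\<^sup>2) \<in> borel_measurable \<PP>"
      by (rule borel_measurable_strongly_measurable[OF w(1)]) (intro continuous_intros)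
    show "AE \<omega> in \<PP>. (w \<omega> \<bullet> \<psi> l k)\<^sup>2 = (d l k \<omega>)\<^sup>2"
      using d_AE by eventually_elim (use k in auto)
  qed
  have d_sums: "AE \<omega> in \<PP>. (\<lambda>l. \<Sum>k=1..?M l. (d l k \<omega>)\<^sup>2) sums (norm (P (w \<omega>)))\<^sup>2"
    using d_AE w(2)
  proof eventually_elim
    case (elim \<omega>)
    then have "(\<Sum>k=1..?M l. (d l k \<omega>)\<^sup>2) = (\<Sum>k=1..?M l. (w \<omega> \<bullet> \<psi> l k)\<^sup>2)" for l
      by (intro sum.cong) auto
    then show ?case using parseval[OF elim(2)] by simp
  qed
  have d_int: "integrable \<PP> (\<lambda>\<omega>. (d l k \<omega>)\<^sup>2)" if k: "k \<in> {1..?M l}" for l k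
  proof (rule Bochner_Integration.integrable_bound[OF w(3) d_meas[OF k]])
    \<comment> \<open>For a unit vector, Cauchy-Schwarz bounds the squared coefficient by the
      integrable squared norm of \<open>w\<close>.\<close>
    have "norm (\<psi> l k) = 1"
      using orthonormal_familyD[OF orthonormal k k] by (simp add: norm_eq_sqrt_inner)
    then have "\<bar>x \<bullet> \<psi> l k\<bar> \<le> norm x" for x
      using Cauchy_Schwarz_ineq2[of x "\<psi> l k"] by simp
    then have bound: "(x \<bullet> \<psi> l k)\<^sup>2 \<le> (norm x)\<^sup>2" for x
      by (simp add: abs_le_square_iff[symmetric])
    show "AE \<omega> in \<PP>. norm ((d l k \<omega>)\<^sup>2) \<le> norm ((norm (w \<omega>))\<^sup>2)"
      using d_AE by eventually_elim (use k bound in auto)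
  qed

  \<comment> \<open>The limit itself dominates: partial sums of nonnegative terms stay below the
    total given by Parseval.\<close>
  have "(\<lambda>n. LINT \<omega>|\<PP>. (\<Sum>l<n. \<Sum>k=1..?M l. (d l k \<omega>)\<^sup>2)) \<longlonglongrightarrow> (LINT \<omega>|\<PP>. (norm (P (w \<omega>)))\<^sup>2)"
  proof (rule integral_dominated_convergence[OF Pw_meas _ Pw_int])
    show "(\<lambda>\<omega>. \<Sum>l<n. \<Sum>k=1..?M l. (d l k \<omega>)\<^sup>2) \<in> borel_measurable \<PP>" for n
      by (intro borel_measurable_sum d_meas)
    show "AE \<omega> in \<PP>. (\<lambda>n. \<Sum>l<n. \<Sum>k=1..?M l. (d l k \<omega>)\<^sup>2) \<longlonglongrightarrow> (norm (P (w \<omega>)))\<^sup>2"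
      using d_sums by (simp add: sums_def)
    show "AE \<omega> in \<PP>. norm (\<Sum>l<n. \<Sum>k=1..?M l. (d l k \<omega>)\<^sup>2) \<le> (norm (P (w \<omega>)))\<^sup>2" for n
      using d_sums
    proof eventually_elim
      case (elim \<omega>)
      have "(\<Sum>l<n. \<Sum>k=1..?M l. (d l k \<omega>)\<^sup>2) \<le> (\<Sum>l. \<Sum>k=1..?M l. (d l k \<omega>)\<^sup>2)"
        using sums_summable[OF elim] by (intro sum_le_suminf) (auto intro: sum_nonneg)
      then show ?case
        using sums_unique[OF elim] by (simp add: sum_nonneg)
    qed
  qed
  moreover have "(LINT \<omega>|\<PP>. (\<Sum>l<n. \<Sum>k=1..?M l. (d l k \<omega>)\<^sup>2))
      = (\<Sum>l<n. \<Sum>k=1..?M l. LINT \<omega>|\<PP>. (d l k \<omega>)\<^sup>2)" for n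
  proof -
    have "(LINT \<omega>|\<PP>. (\<Sum>l<n. \<Sum>k=1..?M l. (d l k \<omega>)\<^sup>2))
        = (\<Sum>l<n. LINT \<omega>|\<PP>. (\<Sum>k=1..?M l. (d l k \<omega>)\<^sup>2))"
      by (intro Bochner_Integration.integral_sum Bochner_Integration.integrable_sum d_int)
    also have "\<dots> = (\<Sum>l<n. \<Sum>k=1..?M l. LINT \<omega>|\<PP>. (d l k \<omega>)\<^sup>2)"
      by (intro sum.cong refl Bochner_Integration.integral_sum d_int)
    finally show ?thesis .
  qed
  moreover have "(bochner_norm \<PP> (\<lambda>\<omega>. P (w \<omega>)))\<^sup>2 = (LINT \<omega>|\<PP>. (norm (P (w \<omega>)))\<^sup>2)"
    by (simp add: bochner_norm_def power2_norm_eq_inner)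
  ultimately have "(\<lambda>l. \<Sum>k=1..?M l. LINT \<omega>|\<PP>. (d l k \<omega>)\<^sup>2) sums
      (bochner_norm \<PP> (\<lambda>\<omega>. P (w \<omega>)))\<^sup>2"
    by (simp add: sums_def)
  with expansion Pw_bochner d_int show ?thesis by blast
qed

end
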